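(* Let $\mathcal{G}=\{G_1,G_2,\ldots,G_k\}$, $k\ge 2$, be a family of connected vertex-transitive graphs with a common vertex set $V$, $|V|\ge 3$. Then $\mathrm{Sd}_f(\mathcal{G})=\max_{1\le i\le k}\{\dim_f(G_i)\}$.
   Context: Graphs are finite, simple and undirected. $d_G(x,y)$ is the least number of edges on a path joining $x$ and $y$ in $G$ ($\infty$ if there is none). For distinct $x,y\in V(G)$, $R_G\{x,y\}=\{z\in V(G): d_G(x,z)\ne d_G(y,z)\}$. For a function $g$ on $V$ and $U\subseteq V$, $g(U)=\sum_{s\in U}g(s)$. A resolving function of $G$ is a function $g:V(G)\to[0,1]$ with $g(R_G\{x,y\})\ge 1$ for all distinct $x,y\in V(G)$; the fractional dimension $\dim_f(G)$ is the minimum of $g(V(G))$ over all resolving functions $g$ of $G$. For a family $\mathcal{G}$ of graphs on a common vertex set $V$, a simultaneous resolving function is a function $g:V\to[0,1]$ that is a resolving function of every member of $\mathcal{G}$, and the simultaneous fractional dimension $\mathrm{Sd}_f(\mathcal{G})$ is the minimum of $g(V)$ over all simultaneous resolving functions $g$ of $\mathcal{G}$. *)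

theory Defs
  imports "HOL-Analysis.Analysis" "Graph_Theory.Graph_Theory"
begin

text \<open>
  A finite simple undirected graph is a symmetric loop-free finite digraph whose arcs are
  pairs of vertices, i.e. \<^locale>\<open>pair_graph\<close>: every edge \<open>xy\<close> is represented by the two arcs
  \<open>(x, y)\<close> and \<open>(y, x)\<close>.
\<close>

definition gdist :: "'a pair_pre_digraph \<Rightarrow> 'a \<Rightarrow> 'a \<Rightarrow> enat" where
  "gdist G x y = (INF p \<in> {p. pre_digraph.apath (with_proj G) x p y}. enat (length p))"
  \<comment> \<open>paths are lists of arcs; the infimum is \<open>\<infinity>\<close> if there is no path\<close>

definition automorphism :: "'a pair_pre_digraph \<Rightarrow> ('a \<Rightarrow> 'a) \<Rightarrow> bool" where
  "automorphism G f \<longleftrightarrow> bij_betw f (pverts G) (pverts G) \<and>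
     (\<forall>x\<in>pverts G. \<forall>y\<in>pverts G. (f x, f y) \<in> parcs G \<longleftrightarrow> (x, y) \<in> parcs G)"

definition vertex_transitive :: "'a pair_pre_digraph \<Rightarrow> bool" where
  "vertex_transitive G \<longleftrightarrow>
     (\<forall>x\<in>pverts G. \<forall>y\<in>pverts G. \<exists>f. automorphism G f \<and> f x = y)"

definition resolving_set :: "'a pair_pre_digraph \<Rightarrow> 'a \<Rightarrow> 'a \<Rightarrow> 'a set" where
  "resolving_set G x y = {z \<in> pverts G. gdist G x z \<noteq> gdist G y z}"

text \<open>
  Functions on the vertex set are total functions on the vertex type whose values outside
  the vertex set are irrelevant.
\<close>

definition resolving_function :: "'a pair_pre_digraph \<Rightarrow> ('a \<Rightarrow> real) \<Rightarrow> bool" where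
  "resolving_function G g \<longleftrightarrow> g ` pverts G \<subseteq> {0..1} \<and>
     (\<forall>x\<in>pverts G. \<forall>y\<in>pverts G. x \<noteq> y \<longrightarrow> sum g (resolving_set G x y) \<ge> 1)"

definition simultaneous_resolving_function ::
    "'a set \<Rightarrow> 'a pair_pre_digraph set \<Rightarrow> ('a \<Rightarrow> real) \<Rightarrow> bool" where
  "simultaneous_resolving_function V \<G> g \<longleftrightarrow>
     g ` V \<subseteq> {0..1} \<and> (\<forall>G\<in>\<G>. resolving_function G g)"

text \<open>
  On the reals, \<open>LEAST\<close> is the minimum of a set, provided that it exists. That it does is
  shown in \<open>Sd_f_attained\<close> and \<open>dim_f_attained\<close> below.
\<close>

definition dim_f :: "'a pair_pre_digraph \<Rightarrow> real" where
  "dim_f G = (LEAST t. \<exists>g. resolving_function G g \<and> t = sum g (pverts G))"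

definition Sd_f :: "'a set \<Rightarrow> 'a pair_pre_digraph set \<Rightarrow> real" where
  "Sd_f V \<G> = (LEAST t. \<exists>g. simultaneous_resolving_function V \<G> g \<and> t = sum g V)"

lemma gdist_self:
  assumes "x \<in> pverts G"
  shows "gdist G x x = 0"
proof -
  have "pre_digraph.apath (with_proj G) x [] x"
    using assms by (simp add: pre_digraph.apath_def pre_digraph.awalk_def pre_digraph.cas.simps
        pre_digraph.awalk_verts.simps)
  then have "gdist G x x \<le> enat (length ([] :: ('a \<times> 'a) list))"
    unfolding gdist_def by (intro INF_lower) simp
  then show ?thesis by (simp add: zero_enat_def[symmetric])
qed

lemma gdist_neq_0:
  assumes "x \<noteq> y"
  shows "gdist G y x \<noteq> 0"
proof -
  have "1 \<le> gdist G y x"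
    unfolding gdist_def
  proof (rule INF_greatest)
    fix p assume "p \<in> {p. pre_digraph.apath (with_proj G) y p x}"
    then have "p \<noteq> []"
      using assms by (auto simp: pre_digraph.apath_def pre_digraph.awalk_def pre_digraph.cas.simps)
    then show "1 \<le> enat (length p)"
      by (cases p) (auto simp: one_enat_def)
  qed
  then show ?thesis by auto
qed

lemma resolving_function_const_1:
  assumes "finite (pverts G)"
  shows "resolving_function G (\<lambda>_. 1)"
proof -
  have "1 \<le> card (resolving_set G x y)" if "x \<in> pverts G" "x \<noteq> y" for x y
  proof -
    have "x \<in> resolving_set G x y"
      using that gdist_self[of x G] gdist_neq_0[of x y G] by (auto simp: resolving_set_def)
    moreover have "finite (resolving_set G x y)"
      using assms by (simp add: resolving_set_def)
    ultimately show ?thesis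
      by (metis One_nat_def Suc_leI card_gt_0_iff empty_iff)
  qed
  then show ?thesis
    by (auto simp: resolving_function_def)
qed

lemma simultaneous_resolving_function_cong:
  assumes "\<And>G. G \<in> \<G> \<Longrightarrow> pverts G = V" and "\<And>v. v \<in> V \<Longrightarrow> g v = h v"
  shows "simultaneous_resolving_function V \<G> g \<longleftrightarrow> simultaneous_resolving_function V \<G> h"
proof -
  have "sum g (resolving_set G x y) = sum h (resolving_set G x y)" if "G \<in> \<G>" for G x y
    using that assms by (intro sum.cong) (auto simp: resolving_set_def)
  then show ?thesis
    using assms by (auto simp: simultaneous_resolving_function_def resolving_function_def image_subset_iff)
qed

lemma minimal_simultaneous_resolving_function:
  assumes "finite V" and V: "\<And>G. G \<in> \<G> \<Longrightarrow> pverts G = V"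
  obtains g where "simultaneous_resolving_function V \<G> g"
    and "\<And>h. simultaneous_resolving_function V \<G> h \<Longrightarrow> sum g V \<le> sum h V"
proof -
  define K where "K = (\<Pi>\<^sub>E v\<in>UNIV. if v \<in> V then {0..1::real} else {0})"
  define S where "S = K \<inter> {g. simultaneous_resolving_function V \<G> g}"
  have K: "g ` V \<subseteq> {0..1}" if "g \<in> K" for g
  proof
    fix t assume "t \<in> g ` V"
    then obtain v where "v \<in> V" "t = g v" by blast
    moreover have "g v \<in> (if v \<in> V then {0..1} else {0})"
      using that unfolding K_def by (rule PiE_mem) simp
    ultimately show "t \<in> {0..1}" by simp
  qed
  have cont: "continuous_on UNIV (\<lambda>g::'a \<Rightarrow> real. sum g A)" for A
    by (intro continuous_intros continuous_on_product_coordinates)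
  have "compactin (product_topology (\<lambda>_. euclidean) UNIV) K"
    unfolding K_def by (subst compactin_PiE) auto
  then have "compact K"
    by (simp add: euclidean_product_topology)
  have resolving_iff: "resolving_function G g \<longleftrightarrow>
      (\<forall>x\<in>V. \<forall>y\<in>V - {x}. 1 \<le> sum g (resolving_set G x y))" if "G \<in> \<G>" "g \<in> K" for G g
    unfolding resolving_function_def V[OF that(1)] Ball_def Diff_iff
    by (simp only: K[OF that(2)] simp_thms singleton_iff eq_commute imp_conjL)
  have S_eq: "S = K \<inter> (\<Inter>G\<in>\<G>. \<Inter>x\<in>V. \<Inter>y\<in>V - {x}. {g. 1 \<le> sum g (resolving_set G x y)})"
    (is "_ = _ \<inter> ?C")
  proof (rule set_eqI)
    fix g
    show "g \<in> S \<longleftrightarrow> g \<in> K \<inter> ?C"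
    proof (cases "g \<in> K")
      case True
      have "simultaneous_resolving_function V \<G> g \<longleftrightarrow> (\<forall>G\<in>\<G>. resolving_function G g)"
        unfolding simultaneous_resolving_function_def by (simp only: K[OF True] simp_thms)
      also have "\<dots> \<longleftrightarrow> g \<in> ?C"
        unfolding INT_iff mem_Collect_eq
        by (rule ball_cong[OF refl]) (rule resolving_iff[OF _ True])
      finally show ?thesis
        unfolding S_def Int_iff mem_Collect_eq by (rule arg_cong)
    next
      case False
      then show ?thesis
        unfolding S_def Int_iff by (simp only: simp_thms)
    qed
  qed
  have "closed {g::'a \<Rightarrow> real. 1 \<le> sum g (resolving_set G x y)}" for G x y
    using continuous_on_const cont by (rule closed_Collect_le)
  with \<open>compact K\<close> have "compact S"
    unfolding S_eq by (intro compact_Int_closed closed_INT ballI)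
  have const: "simultaneous_resolving_function V \<G> (\<lambda>_. 1)"
    using assms resolving_function_const_1 by (auto simp: simultaneous_resolving_function_def)
  have restr: "(\<lambda>v. if v \<in> V then h v else 0) \<in> S" if "simultaneous_resolving_function V \<G> h" for h
  proof -
    have "simultaneous_resolving_function V \<G> (\<lambda>v. if v \<in> V then h v else 0)"
      using that by (subst simultaneous_resolving_function_cong[OF V, where h = h]) auto
    then show ?thesis
      by (auto simp: S_def K_def simultaneous_resolving_function_def image_subset_iff)
  qed
  have "S \<noteq> {}"
    using restr[OF const] by blast
  with \<open>compact S\<close> obtain g where g: "g \<in> S" "\<And>h. h \<in> S \<Longrightarrow> sum g V \<le> sum h V"
    using continuous_attains_inf[of S "\<lambda>g. sum g V"] continuous_on_subset[OF cont subset_UNIV]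
    by metis
  show thesis
  proof
    show "simultaneous_resolving_function V \<G> g"
      using g(1) by (simp add: S_def)
    show "sum g V \<le> sum h V" if "simultaneous_resolving_function V \<G> h" for h
      using g(2)[OF restr[OF that]] by simp
  qed
qed

lemma Sd_f_attained:
  assumes "finite V" and "\<And>G. G \<in> \<G> \<Longrightarrow> pverts G = V"
  shows "\<exists>g. simultaneous_resolving_function V \<G> g \<and> Sd_f V \<G> = sum g V"
    and "simultaneous_resolving_function V \<G> h \<Longrightarrow> Sd_f V \<G> \<le> sum h V"
proof -
  obtain g where g: "simultaneous_resolving_function V \<G> g"
    "\<And>h. simultaneous_resolving_function V \<G> h \<Longrightarrow> sum g V \<le> sum h V"
    using minimal_simultaneous_resolving_function assms by metis
  then have *: "Sd_f V \<G> = sum g V"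
    unfolding Sd_f_def by (intro Least_equality) auto
  show "\<exists>g. simultaneous_resolving_function V \<G> g \<and> Sd_f V \<G> = sum g V"
    using * g(1) by blast
  show "Sd_f V \<G> \<le> sum h V" if "simultaneous_resolving_function V \<G> h"
    using * g(2)[OF that] by simp
qed

lemma dim_f_attained:
  assumes "finite (pverts G)"
  shows "\<exists>g. resolving_function G g \<and> dim_f G = sum g (pverts G)"
    and "resolving_function G h \<Longrightarrow> dim_f G \<le> sum h (pverts G)"
proof -
  have *: "simultaneous_resolving_function (pverts G) {G} g \<longleftrightarrow> resolving_function G g" for g
    by (auto simp: simultaneous_resolving_function_def resolving_function_def)
  then have eq: "dim_f G = Sd_f (pverts G) {G}"
    unfolding dim_f_def Sd_f_def by (simp only:)
  have "pverts H = pverts G" if "H \<in> {G}" for H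
    using that by simp
  note attained = Sd_f_attained[where \<G> = "{G}", OF assms this, unfolded *, folded eq]
  show "\<exists>g. resolving_function G g \<and> dim_f G = sum g (pverts G)"
    using attained(1) .
  show "resolving_function G h \<Longrightarrow> dim_f G \<le> sum h (pverts G)"
    using attained(2) .
qed

end

theory Submission
  imports Defs "HOL-Combinatorics.Permutations"
begin

text \<open>
  The sum of a resolving function \<open>g\<close> over \<open>V\<close> bounds the fractional dimension from above, so
  every simultaneous resolving function witnesses \<open>dim_f (G i) \<le> Sd_f V (G ` {1..k})\<close>.  The
  content is the reverse inequality, and the point is that a vertex-transitive graph has an
  optimal resolving function that is \<^emph>\<open>constant\<close>.  Constant functions need no coordination between
  the graphs: they differ only in their value, and the largest of them resolves all members of
  the family at once.

  The constant function is obtained by averaging an optimal \<open>g\<close> over the automorphisms.  An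
  automorphism \<open>f\<close> preserves distances, hence maps \<open>R{x,y}\<close> onto \<open>R{f x, f y}\<close>, and
  so \<open>g \<circ> f\<close> has sum at least 1 over \<open>R{x,y}\<close> as well.  By transitivity the average of \<open>g (f z)\<close>
  over all \<open>f\<close> does not depend on \<open>z\<close>, which forces it to be \<open>g(V) / |V| = dim_f G / |V|\<close>
  (\<open>sum_over_transitive_permutations\<close>).  Thus \<open>|R{x,y}| \<cdot> dim_f G / |V| \<ge> 1\<close> for all
  distinct \<open>x\<close>, \<open>y\<close> (\<open>card_resolving_set_lower_bound\<close>), that is, the constant function
  \<open>dim_f G / |V|\<close> is resolving.  Raising the constant, up to 1, keeps it so
  (\<open>resolving_function_const\<close>).
\<close>

section \<open>Automorphisms preserve distances\<close>

lemma automorphism_inv_into: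
  assumes "automorphism G f"
  shows "automorphism G (inv_into (pverts G) f)"
proof -
  have bij: "bij_betw f (pverts G) (pverts G)"
    using assms by (simp add: automorphism_def)
  have inv: "bij_betw (inv_into (pverts G) f) (pverts G) (pverts G)"
    using bij by (rule bij_betw_inv_into)
  then have "inv_into (pverts G) f x \<in> pverts G" if "x \<in> pverts G" for x
    using that by (rule bij_betwE[THEN bspec])
  then have "(inv_into (pverts G) f x, inv_into (pverts G) f y) \<in> parcs G \<longleftrightarrow> (x, y) \<in> parcs G"
    if "x \<in> pverts G" "y \<in> pverts G" for x y
    using assms that bij_betw_inv_into_right[OF bij] unfolding automorphism_def by metis
  with inv show ?thesis
    by (simp add: automorphism_def)
qed

lemma automorphism_comp:
  assumes "automorphism G f" and "automorphism G h"
  shows "automorphism G (f \<circ> h)"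
proof -
  have "bij_betw (f \<circ> h) (pverts G) (pverts G)"
    using assms unfolding automorphism_def by (blast intro: bij_betw_trans)
  moreover have "h x \<in> pverts G" if "x \<in> pverts G" for x
    using assms(2) that bij_betwE unfolding automorphism_def by blast
  ultimately show ?thesis
    using assms by (simp add: automorphism_def)
qed

lemma automorphism_cong:
  assumes "\<And>x. x \<in> pverts G \<Longrightarrow> f x = h x"
  shows "automorphism G f \<longleftrightarrow> automorphism G h"
  using assms bij_betw_cong[of "pverts G" f h] by (simp add: automorphism_def)

lemma apath_automorphism:
  assumes "pair_wf_digraph G" and f: "automorphism G f"
    and p: "pre_digraph.apath (with_proj G) x p y"
  shows "pre_digraph.apath (with_proj G) (f x) (map (map_prod f f) p) (f y)"
proof -
  interpret pair_wf_digraph G by fact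
  have x: "x \<in> pverts G" and arcs: "set p \<subseteq> parcs G" and cas: "pcas x p y"
    and dist: "distinct (pawalk_verts x p)"
    using p by (auto simp: apath_def awalk_def)
  have bij: "bij_betw f (pverts G) (pverts G)"
    using f by (simp add: automorphism_def)
  have cas': "pcas (f x) (map (map_prod f f) p) (f y)"
    using cas by (induction p arbitrary: x) auto
  have verts': "pawalk_verts (f x) (map (map_prod f f) p) = map f (pawalk_verts x p)"
    by (induction p arbitrary: x) auto
  have "set (pawalk_verts x p) \<subseteq> pverts G"
    using awalk_verts_in_verts[OF x arcs] by blast
  then have "inj_on f (set (pawalk_verts x p))"
    using bij by (meson bij_betw_imp_inj_on inj_on_subset)
  with dist have dist': "distinct (pawalk_verts (f x) (map (map_prod f f) p))"
    by (simp add: verts' distinct_map)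
  have "(f u, f v) \<in> parcs G" if "(u, v) \<in> parcs G" for u v
    using that f wellformed' unfolding automorphism_def by metis
  with arcs have "set (map (map_prod f f) p) \<subseteq> parcs G"
    by auto
  with x cas' dist' bij show ?thesis
    by (auto simp: apath_def awalk_def dest: bij_betwE)
qed

lemma gdist_automorphism_le:
  assumes "pair_wf_digraph G" and "automorphism G f"
  shows "gdist G (f x) (f y) \<le> gdist G x y"
  unfolding gdist_def
proof (rule INF_mono)
  fix p assume "p \<in> {p. pre_digraph.apath (with_proj G) x p y}"
  then show "\<exists>q\<in>{q. pre_digraph.apath (with_proj G) (f x) q (f y)}. enat (length q) \<le> enat (length p)"
    using apath_automorphism[OF assms] by (intro bexI[of _ "map (map_prod f f) p"]) auto
qed

lemma gdist_automorphism:
  assumes "pair_wf_digraph G" and f: "automorphism G f"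
    and "x \<in> pverts G" and "y \<in> pverts G"
  shows "gdist G (f x) (f y) = gdist G x y"
proof (rule antisym)
  show "gdist G (f x) (f y) \<le> gdist G x y"
    using assms by (intro gdist_automorphism_le)
  let ?h = "inv_into (pverts G) f"
  have "inj_on f (pverts G)"
    using f by (simp add: automorphism_def bij_betw_def)
  then have "gdist G x y = gdist G (?h (f x)) (?h (f y))"
    using assms by simp
  also have "\<dots> \<le> gdist G (f x) (f y)"
    using assms automorphism_inv_into by (intro gdist_automorphism_le)
  finally show "gdist G x y \<le> gdist G (f x) (f y)" .
qed

lemma resolving_set_automorphism:
  assumes "pair_wf_digraph G" and f: "automorphism G f"
    and "x \<in> pverts G" and "y \<in> pverts G"
  shows "resolving_set G (f x) (f y) = f ` resolving_set G x y"
proof -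
  have "f ` pverts G = pverts G"
    using f by (simp add: automorphism_def bij_betw_def)
  then have "resolving_set G (f x) (f y) = f ` {z \<in> pverts G. gdist G (f x) (f z) \<noteq> gdist G (f y) (f z)}"
    using Compr_image_eq[of f "pverts G" "\<lambda>z. gdist G (f x) z \<noteq> gdist G (f y) z"]
    by (simp add: resolving_set_def)
  also have "{z \<in> pverts G. gdist G (f x) (f z) \<noteq> gdist G (f y) (f z)} = resolving_set G x y"
    unfolding resolving_set_def
    using assms(3,4) by (intro Collect_cong conj_cong) (simp_all add: gdist_automorphism[OF assms(1,2)])
  finally show ?thesis .
qed

section \<open>Averaging over a transitive set of permutations\<close>

text \<open>
  Precomposition with a fixed \<open>h \<in> A\<close> is an injective map of \<open>A\<close> into itself, hence a bijection
  since \<open>A\<close> is finite.  So the sum on the left takes the same value at \<open>z\<close> and \<open>h z\<close>, and by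
  transitivity at all points of \<open>V\<close>.  Summing over \<open>z\<close> then determines that value.
\<close>

lemma sum_over_transitive_permutations:
  fixes g :: "'a \<Rightarrow> real"
  assumes "finite V" and perm: "\<And>f. f \<in> A \<Longrightarrow> f permutes V"
    and comp: "\<And>f h. f \<in> A \<Longrightarrow> h \<in> A \<Longrightarrow> f \<circ> h \<in> A"
    and trans: "\<And>x y. x \<in> V \<Longrightarrow> y \<in> V \<Longrightarrow> \<exists>f\<in>A. f x = y"
    and "z \<in> V"
  shows "real (card V) * (\<Sum>f\<in>A. g (f z)) = real (card A) * sum g V"
proof -
  have "finite A"
    using finite_permutations[OF \<open>finite V\<close>] perm by (auto intro: rev_finite_subset)
  have shift: "(\<Sum>f\<in>A. g (f (h u))) = (\<Sum>f\<in>A. g (f u))" if "h \<in> A" for h u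
  proof -
    have inj: "inj_on (\<lambda>f. f \<circ> h) A"
      using permutes_surj[OF perm[OF that]] by (intro inj_onI) (metis fun_eq_iff comp_apply surjD)
    moreover have "(\<lambda>f. f \<circ> h) ` A \<subseteq> A"
      using comp that by blast
    ultimately have "(\<lambda>f. f \<circ> h) ` A = A"
      using \<open>finite A\<close> by (intro endo_inj_surj)
    with inj have "bij_betw (\<lambda>f. f \<circ> h) A A"
      by (simp add: bij_betw_def)
    from sum.reindex_bij_betw[OF this, of "\<lambda>f. g (f u)"] show ?thesis
      by simp
  qed
  have const: "(\<Sum>f\<in>A. g (f u)) = (\<Sum>f\<in>A. g (f z))" if "u \<in> V" for u
    using trans[OF \<open>z \<in> V\<close> that] shift by metis
  have "real (card V) * (\<Sum>f\<in>A. g (f z)) = (\<Sum>u\<in>V. \<Sum>f\<in>A. g (f u))"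
    by (simp add: const)
  also have "\<dots> = (\<Sum>f\<in>A. \<Sum>u\<in>V. g (f u))"
    by (rule sum.swap)
  also have "\<dots> = (\<Sum>f\<in>A. sum g V)"
    by (rule sum.cong[OF refl]) (rule sum.reindex_bij_betw[OF permutes_imp_bij[OF perm]])
  finally show ?thesis
    by simp
qed

section \<open>Constant resolving functions of vertex-transitive graphs\<close>

text \<open>
  Summing \<open>1 \<le> g(R{f x, f y}) = \<Sum>z\<in>R{x,y}. g (f z)\<close> over all automorphisms \<open>f\<close>, where \<open>g\<close> is an
  optimal resolving function, and exchanging the sums leaves a sum of equal terms on the right.
\<close>

lemma card_resolving_set_lower_bound:
  assumes wf: "pair_wf_digraph G" and fin: "finite (pverts G)" and "vertex_transitive G"
    and x: "x \<in> pverts G" and y: "y \<in> pverts G" and "x \<noteq> y"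
  shows "real (card (pverts G)) \<le> real (card (resolving_set G x y)) * dim_f G"
proof -
  let ?V = "pverts G" and ?R = "resolving_set G x y"
  obtain g where g: "resolving_function G g" and dim: "dim_f G = sum g ?V"
    using dim_f_attained(1)[OF fin] by blast
  \<comment> \<open>Requiring the automorphisms to be the identity outside of \<open>V\<close> makes them finite in number.\<close>
  define A where "A = {f. f permutes ?V \<and> automorphism G f}"
  have perm: "f permutes ?V" and auto: "automorphism G f" if "f \<in> A" for f
    using that by (simp_all add: A_def)
  have comp: "f \<circ> h \<in> A" if "f \<in> A" "h \<in> A" for f h
    using that by (simp add: A_def permutes_compose automorphism_comp)
  have trans: "\<exists>f\<in>A. f u = v" if uv: "u \<in> ?V" "v \<in> ?V" for u v
  proof -
    obtain f where f: "automorphism G f" "f u = v"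
      using \<open>vertex_transitive G\<close> uv unfolding vertex_transitive_def by blast
    let ?f = "\<lambda>w. if w \<in> ?V then f w else w"
    have aut: "automorphism G ?f"
      using f(1) automorphism_cong[of G f ?f] by simp
    then have "?f permutes ?V"
      by (intro bij_imp_permutes) (auto simp: automorphism_def)
    with aut have "?f \<in> A"
      by (simp add: A_def)
    then show ?thesis
      using uv f(2) by (intro bexI[of _ ?f]) simp_all
  qed
  have sum_g: "1 \<le> (\<Sum>z\<in>?R. g (f z))" if "f \<in> A" for f
  proof -
    have inj: "inj f"
      using perm[OF that] by (rule permutes_inj)
    have "f x \<in> ?V" "f y \<in> ?V" "f x \<noteq> f y"
      using x y \<open>x \<noteq> y\<close> by (simp_all add: permutes_in_image[OF perm[OF that]] inj_eq[OF inj])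
    then have "1 \<le> sum g (resolving_set G (f x) (f y))"
      using g by (simp add: resolving_function_def)
    also have "\<dots> = sum g (f ` ?R)"
      using resolving_set_automorphism[OF wf auto[OF that] x y] by simp
    also have "\<dots> = (\<Sum>z\<in>?R. g (f z))"
      using inj by (subst sum.reindex) (auto intro: inj_on_subset)
    finally show ?thesis .
  qed
  have "finite A"
    using finite_permutations[OF fin] by (rule rev_finite_subset) (auto simp: A_def)
  moreover have "A \<noteq> {}"
    using trans[OF x x] by blast
  ultimately have pos: "0 < real (card A)"
    by (simp add: card_gt_0_iff)
  have "real (card A) * real (card ?V) = real (card ?V) * (\<Sum>f\<in>A. 1)"
    by simp
  also have "\<dots> \<le> real (card ?V) * (\<Sum>f\<in>A. \<Sum>z\<in>?R. g (f z))"
    using sum_g by (intro mult_left_mono sum_mono) auto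
  also have "\<dots> = (\<Sum>z\<in>?R. real (card ?V) * (\<Sum>f\<in>A. g (f z)))"
    by (subst sum.swap) (simp add: sum_distrib_left)
  also have "\<dots> = (\<Sum>z\<in>?R. real (card A) * dim_f G)"
    unfolding dim using sum_over_transitive_permutations[OF fin perm comp trans]
    by (intro sum.cong) (auto simp: resolving_set_def)
  finally have "real (card A) * real (card ?V) \<le> real (card A) * (real (card ?R) * dim_f G)"
    by (simp add: mult.left_commute)
  with pos show ?thesis
    by simp
qed

lemma dim_f_nonneg:
  assumes "finite (pverts G)"
  shows "0 \<le> dim_f G"
proof -
  obtain g where "resolving_function G g" "dim_f G = sum g (pverts G)"
    using dim_f_attained(1)[OF assms] by blast
  then show ?thesis
    by (auto simp: resolving_function_def intro!: sum_nonneg)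
qed

lemma dim_f_le_card:
  assumes "finite (pverts G)"
  shows "dim_f G \<le> real (card (pverts G))"
  using dim_f_attained(2)[OF assms resolving_function_const_1[OF assms]] by simp

text \<open>
  The value \<open>t\<close> ranges above \<open>dim_f G\<close> so that one constant can serve several graphs of
  different fractional dimensions.
\<close>

lemma resolving_function_const:
  assumes "pair_wf_digraph G" and fin: "finite (pverts G)" and "vertex_transitive G"
    and t: "dim_f G \<le> t" "t \<le> real (card (pverts G))"
  shows "resolving_function G (\<lambda>_. t / real (card (pverts G)))"
  unfolding resolving_function_def
proof (intro conjI ballI impI)
  have "0 \<le> t"
    using dim_f_nonneg[OF fin] t(1) by linarith
  with t(2) show "(\<lambda>_. t / real (card (pverts G))) ` pverts G \<subseteq> {0..1}"
    by (auto simp: divide_le_eq_1)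
next
  fix x y assume xy: "x \<in> pverts G" "y \<in> pverts G" "x \<noteq> y"
  then have pos: "0 < real (card (pverts G))"
    using fin by (auto simp: card_gt_0_iff)
  have "real (card (pverts G)) \<le> real (card (resolving_set G x y)) * dim_f G"
    using assms xy by (intro card_resolving_set_lower_bound)
  also have "\<dots> \<le> real (card (resolving_set G x y)) * t"
    using t(1) by (intro mult_left_mono) auto
  finally show "1 \<le> (\<Sum>z\<in>resolving_set G x y. t / real (card (pverts G)))"
    using pos by simp
qed

section \<open>The simultaneous fractional dimension\<close>

theorem proposition2p11:
  fixes V :: "'a set" and G :: "nat \<Rightarrow> 'a pair_pre_digraph" and k :: nat
  assumes "k \<ge> 2"
    and "card V \<ge> 3"
    and "\<And>i. i \<in> {1..k} \<Longrightarrow> pair_graph (G i)"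
    and "\<And>i. i \<in> {1..k} \<Longrightarrow> pverts (G i) = V"
    and "\<And>i. i \<in> {1..k} \<Longrightarrow> Digraph_Component.connected (with_proj (G i))"
    and "\<And>i. i \<in> {1..k} \<Longrightarrow> vertex_transitive (G i)"
  shows "Sd_f V (G ` {1..k}) = (MAX i\<in>{1..k}. dim_f (G i))"
proof (rule antisym)
  let ?D = "MAX i\<in>{1..k}. dim_f (G i)"
  have "finite V" and pos: "0 < real (card V)"
    using assms(2) card_ge_0_finite[of V] by auto
  have ne: "{1..k} \<noteq> {}"
    using assms(1) by simp
  have V: "pverts H = V" if "H \<in> G ` {1..k}" for H
    using that assms(4) by auto
  show "Sd_f V (G ` {1..k}) \<le> ?D"
  proof -
    have D_le: "?D \<le> real (card V)"
      using ne assms(4) dim_f_le_card \<open>finite V\<close> by (subst Max_le_iff) force+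
    have "resolving_function (G i) (\<lambda>_. ?D / real (card V))" if i: "i \<in> {1..k}" for i
    proof -
      have "pair_wf_digraph (G i)"
        using assms(3)[OF i] by (simp add: pair_graph_def pair_digraph_def pair_fin_digraph_def)
      moreover have "dim_f (G i) \<le> ?D"
        using i by (intro Max_ge) auto
      ultimately show ?thesis
        using resolving_function_const[of "G i" ?D] assms(4,6)[OF i] D_le \<open>finite V\<close> by simp
    qed
    moreover from this[of 1] have "(\<lambda>_. ?D / real (card V)) ` V \<subseteq> {0..1}"
      using assms(1) assms(4)[of 1] by (simp add: resolving_function_def)
    ultimately have "simultaneous_resolving_function V (G ` {1..k}) (\<lambda>_. ?D / real (card V))"
      by (simp add: simultaneous_resolving_function_def)
    then have "Sd_f V (G ` {1..k}) \<le> (\<Sum>v\<in>V. ?D / real (card V))"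
      by (intro Sd_f_attained(2) \<open>finite V\<close> V)
    also have "\<dots> = ?D"
      using pos by simp
    finally show ?thesis .
  qed
  show "?D \<le> Sd_f V (G ` {1..k})"
  proof -
    obtain g where g: "simultaneous_resolving_function V (G ` {1..k}) g"
      and Sd: "Sd_f V (G ` {1..k}) = sum g V"
      using Sd_f_attained(1)[OF \<open>finite V\<close> V] by blast
    have "dim_f (G i) \<le> sum g V" if i: "i \<in> {1..k}" for i
      using dim_f_attained(2)[of "G i" g] g i assms(4)[OF i] \<open>finite V\<close>
      by (simp add: simultaneous_resolving_function_def)
    with ne Sd show ?thesis
      by (subst Max_le_iff) auto
  qed
qed

end
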